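(* Let $I\subset R_0$ be an ideal and let $g\in R_0$. Then $$D_0[I:\langle g\rangle] = g\cdot D_0[I],$$ where $g\cdot D_0[I]=\{g\cdot q : q\in D_0[I]\}$.
   Context: Let $R=\mathbb{C}[x_1,\dots,x_N]$, $\mathfrak m=\langle x_1,\dots,x_N\rangle$, and let $R_0=R_{\mathfrak m}$ be the localization of $R$ at $\mathfrak m$ (rational functions with denominators not vanishing at the origin). For $\alpha\in(\mathbb{Z}_{\ge 0})^N$ let $\partial^\alpha:R_0\to\mathbb{C}$ be the functional $\partial^\alpha(g)=\left(\frac{1}{\alpha!}\frac{\partial^{|\alpha|}g}{\partial x^\alpha}\right)(0)$, with $\alpha!=\alpha_1!\cdots\alpha_N!$ and $|\alpha|=\sum_i\alpha_i$. Let $D_0=\operatorname{span}_{\mathbb{C}}\{\partial^\alpha : \alpha\in(\mathbb{Z}_{\ge 0})^N\}$ (finite linear combinations). For an ideal $J\subset R_0$, the (Macaulay) dual space is $D_0[J]=\{q\in D_0 : q(f)=0\text{ for all } f\in J\}$. The ring $R_0$ acts on $D_0$ by $(g\cdot q)(f)=q(gf)$ for $g,f\in R_0$, $q\in D_0$; in particular $x_i\cdot\partial^\alpha=\partial^{\alpha-e_i}$ (interpreted as $0$ if $\alpha_i=0$). The colon ideal is $I:\langle g\rangle=\{f\in R_0 : gf\in I\}$. *)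

theory Defs
  imports
    Complex_Main
    "HOL-Library.Poly_Mapping"
    "HOL-Computational_Algebra.Fraction_Field"
begin

text \<open>
  The variables are indexed by a nonempty finite linearly ordered type \<open>'n\<close>, which plays the role
  of \<open>{1, \<dots>, N}\<close>; the order makes the polynomial ring an instance of \<^class>\<open>idom\<close>.
  Exponent vectors and multi-indices have type \<open>'n \<Rightarrow>\<^sub>0 nat\<close>.
\<close>

abbreviation "lookup \<equiv> Poly_Mapping.lookup"
abbreviation "keys \<equiv> Poly_Mapping.keys"
abbreviation "single \<equiv> Poly_Mapping.single"

type_synonym 'n cpoly = "('n \<Rightarrow>\<^sub>0 nat) \<Rightarrow>\<^sub>0 complex"

definition poly_eval :: "('n::finite \<Rightarrow> complex) \<Rightarrow> 'n cpoly \<Rightarrow> complex" where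
  "poly_eval a p = (\<Sum>\<beta>\<in>keys p. lookup p \<beta> * (\<Prod>i\<in>UNIV. a i ^ lookup \<beta> i))"

abbreviation eval0 :: "'n::finite cpoly \<Rightarrow> complex" where
  "eval0 \<equiv> poly_eval (\<lambda>_. 0)"

lemma eval0_eq: "eval0 p = lookup p 0"
proof -
  have *: "(\<Prod>i\<in>UNIV. (0::complex) ^ lookup \<beta> i) = (if \<beta> = 0 then 1 else 0)"
    for \<beta> :: "'a \<Rightarrow>\<^sub>0 nat"
  proof (cases "\<beta> = 0")
    case False
    then obtain i where "lookup \<beta> i \<noteq> 0"
      by (metis lookup_zero poly_mapping_eqI)
    then have "\<exists>i\<in>UNIV. (0::complex) ^ lookup \<beta> i = 0"
      by (metis UNIV_I power_0_left)
    with False show ?thesis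
      by simp
  qed simp
  have "eval0 p = (\<Sum>\<beta>\<in>keys p. if \<beta> = 0 then lookup p \<beta> else 0)"
    unfolding poly_eval_def by (intro sum.cong) (simp_all add: *)
  also have "\<dots> = lookup p 0"
    by (simp add: sum.delta' in_keys_iff)
  finally show ?thesis .
qed

lemma single_diff_split:
  fixes \<beta> :: "'n \<Rightarrow>\<^sub>0 nat"
  shows "lookup \<beta> i \<noteq> 0 \<Longrightarrow> \<beta> - single i 1 + single i 1 = \<beta>"
  by (rule poly_mapping_eqI)
    (auto simp: lookup_add lookup_minus lookup_single when_def)

lemma cpoly_induct [case_names zero add]:
  fixes p :: "'n cpoly"
  assumes "P 0" and "\<And>p \<beta> c. P p \<Longrightarrow> P (p + single \<beta> c)"
  shows "P p"
proof (induction p rule: update_induct)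
  case const
  show ?case using assms(1) .
next
  case (update p \<beta> c)
  have "Poly_Mapping.update \<beta> c p = p + single \<beta> c"
    using update(1)
    by (intro poly_mapping_eqI) (auto simp: lookup_update lookup_add lookup_single when_def in_keys_iff)
  then show ?case
    using assms(2) update by metis
qed

lemma lookup_mult_0: "lookup (p * q) 0 = lookup p 0 * lookup q (0 :: 'n \<Rightarrow>\<^sub>0 nat)"
  for p q :: "'n cpoly"
proof -
  have sum0: "a + b = 0 \<longleftrightarrow> a = 0 \<and> b = 0" for a b :: "'n \<Rightarrow>\<^sub>0 nat"
  proof
    assume "a + b = 0"
    then have "lookup a i + lookup b i = 0" for i
      by (metis lookup_add lookup_zero)
    then show "a = 0 \<and> b = 0"
      by (auto intro!: poly_mapping_eqI)
  qed simp
  have *: "lookup (p * single \<beta> c) 0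
      = lookup p 0 * lookup (single \<beta> c) 0" for \<beta> c and p :: "'n cpoly"
    by (induction p rule: cpoly_induct)
      (auto simp: algebra_simps lookup_add mult_single lookup_single when_def sum0)
  show ?thesis
    by (induction q rule: cpoly_induct) (simp_all add: algebra_simps lookup_add *)
qed

lemma eval0_mult: "eval0 (p * q) = eval0 p * eval0 q"
  by (simp add: eval0_eq lookup_mult_0)

lemma eval0_nonzeroD: "eval0 q \<noteq> 0 \<Longrightarrow> q \<noteq> 0"
  by (auto simp: eval0_eq)


subsection \<open>The local ring\<close>

lemma R0_memI:
  "eval0 q \<noteq> 0 \<Longrightarrow> \<exists>p' q'. eval0 q' \<noteq> 0 \<and> Fract p q = Fract p' q'"
  by blast

typedef (overloaded) 'n R0 =
  "{f :: 'n::{finite,linorder} cpoly fract. \<exists>p q. eval0 q \<noteq> 0 \<and> f = Fract p q}"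
  morphisms to_fract R0_of_fract
proof
  show "Fract 0 1 \<in> {f. \<exists>p q. eval0 q \<noteq> 0 \<and> f = Fract p q}"
    by (rule CollectI, rule R0_memI) (simp add: eval0_eq)
qed

setup_lifting type_definition_R0

lemma R0_cases:
  obtains p q where "eval0 q \<noteq> 0" "q \<noteq> 0" "to_fract f = Fract p q"
  using to_fract[of f] eval0_nonzeroD by blast

instantiation R0 :: ("{finite,linorder}") comm_ring_1
begin

lift_definition zero_R0 :: "'a R0" is 0
  by (metis eval0_eq fract_expand(1) lookup_one_zero zero_neq_one)

lift_definition one_R0 :: "'a R0" is 1
  by (metis eval0_eq fract_expand(2) lookup_one_zero zero_neq_one)

lift_definition plus_R0 :: "'a R0 \<Rightarrow> 'a R0 \<Rightarrow> 'a R0" is "(+)"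
  by (elim exE conjE, hypsubst, subst add_fract)
    (auto dest: eval0_nonzeroD intro!: R0_memI simp: eval0_mult)

lift_definition uminus_R0 :: "'a R0 \<Rightarrow> 'a R0" is uminus
  by (metis minus_fract)

lift_definition minus_R0 :: "'a R0 \<Rightarrow> 'a R0 \<Rightarrow> 'a R0" is "(-)"
  by (elim exE conjE, hypsubst, subst diff_fract)
    (auto dest: eval0_nonzeroD intro!: R0_memI simp: eval0_mult)

lift_definition times_R0 :: "'a R0 \<Rightarrow> 'a R0 \<Rightarrow> 'a R0" is "(*)"
  by (elim exE conjE, hypsubst, subst mult_fract)
    (auto intro!: R0_memI simp: eval0_mult)

instance
  by intro_classes (transfer, simp add: algebra_simps)+

end

text \<open>The value at the origin; see \<open>value0_eq\<close> for well-definedness.\<close>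

definition value0 :: "'n::{finite,linorder} R0 \<Rightarrow> complex" where
  "value0 f = (THE c. \<exists>p q. eval0 q \<noteq> 0 \<and> to_fract f = Fract p q \<and> c = eval0 p / eval0 q)"

lemma value0_eq:
  assumes "eval0 q \<noteq> 0" "to_fract f = Fract p q"
  shows "value0 f = eval0 p / eval0 q"
  unfolding value0_def
proof (rule the_equality)
  fix c
  assume "\<exists>p' q'. eval0 q' \<noteq> 0 \<and> to_fract f = Fract p' q' \<and> c = eval0 p' / eval0 q'"
  then obtain p' q' where *: "eval0 q' \<noteq> 0" "to_fract f = Fract p' q'" "c = eval0 p' / eval0 q'"
    by blast
  have "p * q' = p' * q"
    using assms * eval0_nonzeroD by (metis eq_fract(1))
  then have "eval0 p * eval0 q' = eval0 p' * eval0 q"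
    by (metis eval0_mult)
  then show "c = eval0 p / eval0 q"
    using assms(1) * by (simp add: frac_eq_eq)
qed (use assms in blast)


subsection \<open>Partial derivatives\<close>

definition pderiv_poly :: "'n \<Rightarrow> 'n cpoly \<Rightarrow> 'n cpoly" where
  "pderiv_poly i p = (\<Sum>\<beta>\<in>keys p.
     single (\<beta> - single i 1) (of_nat (lookup \<beta> i) * lookup p \<beta>))"

lemma lookup_pderiv_poly:
  "lookup (pderiv_poly i p) \<beta> =
     of_nat (Suc (lookup \<beta> i)) * lookup p (\<beta> + single i 1)"
proof -
  let ?e = "single i (1::nat)"
  have "lookup (pderiv_poly i p) \<beta> =
      (\<Sum>\<gamma>\<in>keys p. of_nat (lookup \<gamma> i) * lookup p \<gamma> when \<gamma> - ?e = \<beta>)"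
    by (simp add: pderiv_poly_def lookup_sum lookup_single)
  also have "\<dots> = (\<Sum>\<gamma>\<in>keys p. if \<gamma> = \<beta> + ?e then of_nat (lookup \<gamma> i) * lookup p \<gamma> else 0)"
  proof (rule sum.cong)
    fix \<gamma>
    show "(of_nat (lookup \<gamma> i) * lookup p \<gamma> when \<gamma> - ?e = \<beta>) =
        (if \<gamma> = \<beta> + ?e then of_nat (lookup \<gamma> i) * lookup p \<gamma> else 0)"
      using single_diff_split[of \<gamma> i] by (cases "lookup \<gamma> i = 0") (auto simp: when_def)
  qed simp
  also have "\<dots> = of_nat (Suc (lookup \<beta> i)) * lookup p (\<beta> + ?e)"
    by (simp add: sum.delta in_keys_iff lookup_add lookup_single)
  finally show ?thesis .
qed

lemma pderiv_poly_add: "pderiv_poly i (p + q) = pderiv_poly i p + pderiv_poly i q"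
  by (rule poly_mapping_eqI) (simp add: lookup_pderiv_poly lookup_add algebra_simps)

lemma pderiv_poly_zero: "pderiv_poly i 0 = 0"
  by (simp add: pderiv_poly_def)

lemma pderiv_poly_single:
  "pderiv_poly i (single \<beta> c) =
     single (\<beta> - single i 1) (of_nat (lookup \<beta> i) * c)"
  by (simp add: pderiv_poly_def)

lemma pderiv_poly_mult:
  "pderiv_poly i (p * q) = pderiv_poly i p * q + p * pderiv_poly i q"
proof -
  let ?e = "single i (1::nat)"
  have shift: "\<beta> + \<gamma> - ?e = (\<beta> - ?e) + \<gamma>" if "lookup \<beta> i \<noteq> 0" for \<beta> \<gamma>
    using that by (intro poly_mapping_eqI) (auto simp: lookup_add lookup_minus lookup_single when_def)
  have single_single: "pderiv_poly i (single \<beta> c * single \<gamma> d) =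
      pderiv_poly i (single \<beta> c) * single \<gamma> d +
      single \<beta> c * pderiv_poly i (single \<gamma> d)" for \<beta> c \<gamma> d
  proof -
    have "single (\<beta> - ?e + \<gamma>) (of_nat (lookup \<beta> i) * c * d) =
        single (\<beta> + \<gamma> - ?e) (of_nat (lookup \<beta> i) * c * d)"
      using shift[of \<beta> \<gamma>] by (cases "lookup \<beta> i = 0") simp_all
    moreover have "single (\<beta> + (\<gamma> - ?e)) (c * (of_nat (lookup \<gamma> i) * d)) =
        single (\<beta> + \<gamma> - ?e) (of_nat (lookup \<gamma> i) * c * d)"
      using shift[of \<gamma> \<beta>]
      by (cases "lookup \<gamma> i = 0") (simp_all add: ac_simps)
    moreover have "single (\<beta> + \<gamma> - ?e) (of_nat (lookup (\<beta> + \<gamma>) i) * (c * d)) =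
        single (\<beta> + \<gamma> - ?e) (of_nat (lookup \<beta> i) * c * d) +
        single (\<beta> + \<gamma> - ?e) (of_nat (lookup \<gamma> i) * c * d)"
      unfolding single_add[symmetric] by (simp add: lookup_add distrib_right mult.assoc)
    ultimately show ?thesis
      by (simp only: pderiv_poly_single mult_single)
  qed
  have "pderiv_poly i (p * single \<gamma> d) =
      pderiv_poly i p * single \<gamma> d + p * pderiv_poly i (single \<gamma> d)"
    for p \<gamma> d
    by (induction p rule: cpoly_induct)
      (simp_all add: pderiv_poly_zero pderiv_poly_add distrib_right single_single)
  then show ?thesis
    by (induction q rule: cpoly_induct)
      (simp_all add: pderiv_poly_zero pderiv_poly_add distrib_left)
qed

lemma quotient_rule_cross:
  fixes p q p' q' dp dq dp' dq' :: "'a::comm_ring_1"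
  assumes "p * q' = p' * q" "dp * q' + p * dq' = dp' * q + p' * dq"
  shows "(dp * q - p * dq) * (q' * q') = (dp' * q' - p' * dq') * (q * q)"
proof -
  have "(dp * q - p * dq) * (q' * q') - (dp' * q' - p' * dq') * (q * q) =
     q * q' * ((dp * q' + p * dq') - (dp' * q + p' * dq))
     - (p * q' - p' * q) * (q * dq' + q' * dq)"
    by (simp add: algebra_simps)
  then show ?thesis
    using assms by simp
qed

lift_definition pderiv_fract ::
    "'n::linorder \<Rightarrow> 'n cpoly fract \<Rightarrow> 'n cpoly fract"
  is "\<lambda>i x. (pderiv_poly i (fst x) * snd x - fst x * pderiv_poly i (snd x), snd x * snd x)"
proof -
  fix i :: 'n and x y :: "'n cpoly \<times> 'n cpoly"
  assume "fractrel x y"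
  obtain p q p' q' where xy: "x = (p, q)" "y = (p', q')"
    by (cases x, cases y)
  have nz: "q \<noteq> 0" "q' \<noteq> 0" and eq: "p * q' = p' * q"
    using \<open>fractrel x y\<close> by (auto simp: xy)
  let ?D = "pderiv_poly i"
  have D: "?D p * q' + p * ?D q' = ?D p' * q + p' * ?D q"
    using arg_cong[OF eq, of ?D] by (simp only: pderiv_poly_mult)
  have "(?D p * q - p * ?D q) * (q' * q') = (?D p' * q' - p' * ?D q') * (q * q)"
    by (rule quotient_rule_cross[OF eq D])
  moreover have "q * q \<noteq> 0" "q' * q' \<noteq> 0"
    using nz by simp_all
  ultimately show "fractrel
      (?D (fst x) * snd x - fst x * ?D (snd x), snd x * snd x)
      (?D (fst y) * snd y - fst y * ?D (snd y), snd y * snd y)"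
    unfolding xy fractrel_iff fst_conv snd_conv by (intro conjI)
qed

lemma pderiv_fract_Fract:
  assumes "q \<noteq> 0"
  shows "pderiv_fract i (Fract p q) =
     Fract (pderiv_poly i p * q - p * pderiv_poly i q) (q * q)"
proof -
  have Fract_abs: "b \<noteq> 0 \<Longrightarrow> Fract a b = abs_fract (a, b)" for a b :: "'a cpoly"
    by (simp add: Fract_def)
  have "fractrel (p, q) (p, q)" and "q * q \<noteq> 0"
    using assms by simp_all
  from this(1)[THEN pderiv_fract.abs_eq, of i] show ?thesis
    unfolding Fract_abs[OF assms] Fract_abs[OF \<open>q * q \<noteq> 0\<close>] fst_conv snd_conv .
qed

lift_definition pderiv_R0 :: "'n::{finite,linorder} \<Rightarrow> 'n R0 \<Rightarrow> 'n R0" is pderiv_fract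
  by (elim exE conjE, hypsubst, subst pderiv_fract_Fract)
    (auto dest: eval0_nonzeroD intro!: R0_memI simp: eval0_mult)

text \<open>
  The order in which the partial derivatives are taken is fixed here, but it does not matter
  since they commute.
\<close>

definition mixed_pderiv :: "('n \<Rightarrow>\<^sub>0 nat) \<Rightarrow> 'n::{finite,linorder} R0 \<Rightarrow> 'n R0" where
  "mixed_pderiv \<alpha> = foldr (\<lambda>i. pderiv_R0 i ^^ lookup \<alpha> i) (sorted_list_of_set UNIV)"


subsection \<open>Dual spaces\<close>

definition dpart :: "('n \<Rightarrow>\<^sub>0 nat) \<Rightarrow> 'n::{finite,linorder} R0 \<Rightarrow> complex" where
  "dpart \<alpha> f = value0 (mixed_pderiv \<alpha> f) / (\<Prod>i\<in>UNIV. fact (lookup \<alpha> i))"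

text \<open>On polynomials, \<^term>\<open>dpart \<alpha>\<close> reads off the coefficient of the monomial with exponent vector \<open>\<alpha>\<close>.\<close>

lemma dpart_poly:
  fixes f :: "'n::{finite,linorder} R0"
  assumes "to_fract f = Fract p 1"
  shows "dpart \<alpha> f = lookup p \<alpha>"
proof -
  have one: "eval0 (1 :: 'n cpoly) = 1"
    by (simp add: eval0_eq)
  have D1: "pderiv_poly i (1 :: 'n cpoly) = 0" for i :: 'n
  proof (rule poly_mapping_eqI)
    fix \<beta> :: "'n \<Rightarrow>\<^sub>0 nat"
    have "lookup (\<beta> + single i 1) i \<noteq> lookup 0 i"
      by (simp add: lookup_add)
    then have "\<beta> + single i 1 \<noteq> 0"
      by metis
    then show "lookup (pderiv_poly i (1 :: 'n cpoly)) \<beta> = lookup 0 \<beta>"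
      by (simp add: lookup_pderiv_poly lookup_one when_def)
  qed
  have step: "to_fract (pderiv_R0 i f) = Fract (pderiv_poly i p) 1"
    if "to_fract f = Fract p 1" for i :: 'n and f :: "'n R0" and p
    by (simp add: pderiv_R0.rep_eq that pderiv_fract_Fract D1)
  have steps: "to_fract ((pderiv_R0 i ^^ n) f) = Fract ((pderiv_poly i ^^ n) p) 1"
    if "to_fract f = Fract p 1" for i :: 'n and n and f :: "'n R0" and p
    by (induction n) (simp_all add: that step)
  have all: "to_fract (foldr (\<lambda>i. pderiv_R0 i ^^ lookup \<alpha> i) xs f) =
      Fract (foldr (\<lambda>i. pderiv_poly i ^^ lookup \<alpha> i) xs p) 1" for xs
    by (induction xs) (simp_all add: assms steps)
  have pow: "lookup ((pderiv_poly i ^^ n) p) \<beta> * fact (lookup \<beta> i) =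
      fact (lookup \<beta> i + n) * lookup p (\<beta> + single i n)" for i :: 'n and n :: nat and p \<beta>
  proof (induction n arbitrary: \<beta>)
    case (Suc n)
    have e: "\<beta> + single i 1 + single i n = \<beta> + single i (Suc n)"
      by (simp add: add.assoc flip: single_add)
    have "lookup ((pderiv_poly i ^^ Suc n) p) \<beta> * fact (lookup \<beta> i) =
      lookup ((pderiv_poly i ^^ n) p) (\<beta> + single i 1) * fact (lookup (\<beta> + single i 1) i)"
      by (simp add: lookup_pderiv_poly lookup_add lookup_single algebra_simps)
    also have "\<dots> = fact (lookup \<beta> i + Suc n) * lookup p (\<beta> + single i (Suc n))"
      unfolding Suc.IH e by (simp add: lookup_add lookup_single)
    finally show ?case .
  qed simp
  have "lookup (foldr (\<lambda>i. pderiv_poly i ^^ lookup \<alpha> i) xs p) \<beta> =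
      (\<Prod>i\<in>set xs. fact (lookup \<alpha> i)) * lookup p (\<beta> + (\<Sum>i\<in>set xs. single i (lookup \<alpha> i)))"
    if "distinct xs" "\<forall>i\<in>set xs. lookup \<beta> i = 0" for xs \<beta>
    using that
  proof (induction xs arbitrary: \<beta>)
    case (Cons i xs)
    have 0: "\<forall>j\<in>set xs. lookup (\<beta> + single i (lookup \<alpha> i)) j = 0"
      using Cons.prems by (auto simp: lookup_add lookup_single when_def)
    show ?case
      using pow[of "lookup \<alpha> i" i "foldr (\<lambda>i. pderiv_poly i ^^ lookup \<alpha> i) xs p" \<beta>]
        Cons.prems Cons.IH[OF _ 0] by (simp add: mult.assoc add.assoc)
  qed simp
  from this[of "sorted_list_of_set UNIV" 0]
  have "lookup (foldr (\<lambda>i. pderiv_poly i ^^ lookup \<alpha> i) (sorted_list_of_set UNIV) p) 0 =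
      (\<Prod>i\<in>UNIV. fact (lookup \<alpha> i)) * lookup p (\<Sum>i\<in>UNIV. single i (lookup \<alpha> i))"
    by simp
  moreover have "(\<Sum>i\<in>UNIV. single i (lookup \<alpha> i)) = \<alpha>"
    by (rule poly_mapping_eqI) (simp add: lookup_sum lookup_single when_def sum.delta)
  ultimately show ?thesis
    using value0_eq[OF _ all, of "sorted_list_of_set UNIV"] one
    by (simp add: dpart_def mixed_pderiv_def eval0_eq)
qed

definition D0 :: "('n::{finite,linorder} R0 \<Rightarrow> complex) set" where
  "D0 = {(\<lambda>f. \<Sum>\<alpha>\<in>A. c \<alpha> * dpart \<alpha> f) | A c. finite A}"

definition dual_space :: "'n::{finite,linorder} R0 set \<Rightarrow> ('n R0 \<Rightarrow> complex) set" where
  "dual_space J = {q \<in> D0. \<forall>f\<in>J. q f = 0}"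

definition act :: "'n::{finite,linorder} R0 \<Rightarrow> ('n R0 \<Rightarrow> complex) \<Rightarrow> 'n R0 \<Rightarrow> complex" where
  "act g q = (\<lambda>f. q (g * f))"

text \<open>An ideal is a submodule of the ring regarded as a module over itself.\<close>

definition is_ideal :: "'a::comm_ring_1 set \<Rightarrow> bool" where
  "is_ideal = module.subspace (*)"

lemma is_ideal_iff:
  "is_ideal I \<longleftrightarrow> 0 \<in> I \<and> (\<forall>a\<in>I. \<forall>b\<in>I. a + b \<in> I) \<and> (\<forall>r. \<forall>a\<in>I. r * a \<in> I)"
proof -
  interpret module "(*) :: 'a \<Rightarrow> 'a \<Rightarrow> 'a"
    by unfold_locales (simp_all add: algebra_simps)
  show ?thesis
    by (auto simp: is_ideal_def subspace_def)
qed

definition colon_principal :: "'a::comm_ring_1 set \<Rightarrow> 'a \<Rightarrow> 'a set" where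
  "colon_principal I g = {f. g * f \<in> I}"

end

theory Submission
  imports Defs
begin

text \<open>
  The functionals in \<^term>\<open>D0\<close> are exactly the linear ones that vanish on a power of the maximal
  ideal \<open>\<mm>\<close>. Hence \<open>g \<cdot> D0[I] \<subseteq> D0[I : g]\<close> is immediate. Conversely, for \<open>q\<close> in \<open>D0[I : g]\<close> the
  functional \<open>g f \<mapsto> q f\<close> has to be extended to \<open>R0\<close> so that it vanishes on \<open>I\<close> and on a power of
  \<open>\<mm>\<close>. Let \<open>Q\<close> be the largest ideal in the kernel of \<open>q\<close>. Zorn's lemma and the ascending
  chain condition give an ideal \<open>P \<supseteq> I\<close> with \<open>P : g \<subseteq> Q\<close> that contains a power of \<open>\<mm>\<close>, so
  \<open>g f + p \<mapsto> q f\<close> is well defined on \<open>(g) + P\<close>, and every linear extension of it will do.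
\<close>


subsection \<open>Dickson's lemma and ascending chains of polynomial ideals\<close>

text \<open>Every sequence has a monotone subsequence, and a decreasing one in the naturals is
  constant from the point where its minimum is attained.\<close>

lemma nat_incseq_subseq:
  fixes s :: "nat \<Rightarrow> nat"
  obtains r :: "nat \<Rightarrow> nat" where "strict_mono r" "\<And>m n. m \<le> n \<Longrightarrow> s (r m) \<le> s (r n)"
proof -
  obtain f where f: "strict_mono f" "monoseq (\<lambda>n. s (f n))"
    using seq_monosub[of s] by blast
  from f(2)[unfolded monoseq_def] show thesis
  proof
    assume "\<forall>m. \<forall>n\<ge>m. s (f m) \<le> s (f n)"
    then show ?thesis
      using that f(1) by simp
  next
    assume dec: "\<forall>m. \<forall>n\<ge>m. s (f n) \<le> s (f m)"
    obtain k where k: "\<And>n. s (f k) \<le> s (f n)"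
      using ex_has_least_nat[of "\<lambda>_. True" 0 "\<lambda>n. s (f n)"] by auto
    have "s (f (k + n)) = s (f k)" for n
      using k dec by (simp add: antisym)
    moreover have "strict_mono (\<lambda>n. f (k + n))"
      using f(1) by (simp add: strict_mono_def)
    ultimately show ?thesis
      using that[of "\<lambda>n. f (k + n)"] by simp
  qed
qed

text \<open>By induction on the set of coordinates, the subsequence is refined once per coordinate.
  The first two terms of the final one are comparable in every coordinate.\<close>

lemma dickson:
  fixes a :: "nat \<Rightarrow> 'n::finite \<Rightarrow>\<^sub>0 nat"
  obtains i j \<gamma> where "i < j" "a j = a i + \<gamma>"
proof -
  have "\<exists>r :: nat \<Rightarrow> nat. strict_mono r \<and> (\<forall>v\<in>V. \<forall>m n. m \<le> n \<longrightarrow> lookup (a (r m)) v \<le> lookup (a (r n)) v)"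
    if "finite V" for V :: "'n set"
    using that
  proof (induction V)
    case empty
    show ?case
      by (rule exI[of _ "\<lambda>n. n"]) (simp add: strict_mono_def)
  next
    case (insert v V)
    then obtain r :: "nat \<Rightarrow> nat" where r: "strict_mono r"
      "\<And>v m n. v \<in> V \<Longrightarrow> m \<le> n \<Longrightarrow> lookup (a (r m)) v \<le> lookup (a (r n)) v"
      by blast
    obtain t :: "nat \<Rightarrow> nat" where t: "strict_mono t"
      "\<And>m n. m \<le> n \<Longrightarrow> lookup (a (r (t m))) v \<le> lookup (a (r (t n))) v"
      using nat_incseq_subseq[of "\<lambda>n. lookup (a (r n)) v"] by blast
    show ?case
      using strict_mono_compose[OF r(1) t(1)] r(2) t(2) strict_mono_less_eq[OF t(1)]
      by (intro exI[of _ "\<lambda>n. r (t n)"]) auto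
  qed
  from this[OF finite[of UNIV]] obtain r :: "nat \<Rightarrow> nat" where r: "strict_mono r"
    "\<And>v m n. m \<le> n \<Longrightarrow> lookup (a (r m)) v \<le> lookup (a (r n)) v"
    by blast
  \<comment> \<open>The truncated difference is exact because \<open>a (r 0)\<close> lies below
    \<open>a (r 1)\<close> in every coordinate.\<close>
  have "a (r 1) = a (r 0) + (a (r 1) - a (r 0))"
    using r(2)[of 0 1] by (intro poly_mapping_eqI) (simp add: lookup_add lookup_minus)
  moreover have "r 0 < r 1"
    using r(1) by (simp add: strict_mono_def)
  ultimately show thesis
    using that by blast
qed

section \<open>Leading exponents for the lexicographic order\<close>

lemma exponent_nonneg: "(0 :: 'n::linorder \<Rightarrow>\<^sub>0 nat) \<le> \<beta>"
proof (rule ccontr)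
  assume "\<not> 0 \<le> \<beta>"
  then have "\<beta> < 0"
    by simp
  then show False
    by transfer (simp add: less_fun_def)
qed

text \<open>In an infinite descending chain Dickson's lemma finds a later term of the form
  \<open>a i + \<gamma>\<close>. Since \<open>\<gamma>\<close> is nonnegative, this term is not
  below \<open>a i\<close>.\<close>

lemma wfp_exponent_less: "wfp ((<) :: ('n::{finite,linorder} \<Rightarrow>\<^sub>0 nat) \<Rightarrow> _)"
proof -
  have False if "\<And>i. a (Suc i) < a i" for a :: "nat \<Rightarrow> 'n \<Rightarrow>\<^sub>0 nat"
  proof -
    obtain i j \<gamma> where ij: "i < j" "a j = a i + \<gamma>"
      by (rule dickson)
    have "a (i + Suc k) < a i" for k
      by (induction k) (use that in \<open>auto intro: less_trans\<close>)
    from this[of "j - i - 1"] have "a j < a i"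
      using ij(1) by simp
    moreover have "a i \<le> a j"
      using add_left_mono[OF exponent_nonneg[of \<gamma>], of "a i"] ij(2) by simp
    ultimately show False
      by simp
  qed
  then show ?thesis
    unfolding wfp_def wf_iff_no_infinite_down_chain by blast
qed

lemma lookup_single_times:
  "lookup (single \<gamma> c * p) (\<gamma> + \<beta>) = c * lookup (p :: 'n cpoly) \<beta>"
  by (induction p rule: cpoly_induct)
    (simp_all add: distrib_left lookup_add mult_single lookup_single when_def)

abbreviation lead :: "'n::linorder cpoly \<Rightarrow> 'n \<Rightarrow>\<^sub>0 nat" where
  "lead p \<equiv> Max (keys p)"

text \<open>One step of polynomial division. A zero remainder is listed separately because
  \<open>lead 0\<close>, the maximum of an empty set, carries no information.\<close>

lemma lead_reduction:
  fixes p q :: "'n::linorder cpoly"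
  assumes "p \<noteq> 0" "q \<noteq> 0" "lead q = lead p + \<gamma>"
  obtains c where "q - single \<gamma> c * p = 0 \<or> lead (q - single \<gamma> c * p) < lead q"
proof -
  \<comment> \<open>The quotient of the leading coefficients makes the two leading terms
    cancel.\<close>
  define c where "c = lookup q (lead q) / lookup p (lead p)"
  define r where "r = q - single \<gamma> c * p"
  have lp: "lookup p (lead p) \<noteq> 0"
    using assms(1) by (metis Max_in finite_keys in_keys_iff keys_eq_empty)
  have "\<beta> < lead q" if "\<beta> \<in> keys r" for \<beta>
  proof -
    have "lookup (single \<gamma> c * p) (lead q) = lookup q (lead q)"
      using lookup_single_times[of \<gamma> c p "lead p"] assms(3) lp by (simp add: c_def add.commute)
    then have "lookup r (lead q) = 0"
      by (simp add: r_def lookup_minus)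
    with that have "\<beta> \<noteq> lead q"
      by auto
    moreover have "\<beta> \<le> lead q"
    proof -
      have "\<beta> \<in> keys q \<or> \<beta> \<in> keys (single \<gamma> c * p)"
        using that keys_diff[of q "single \<gamma> c * p"] by (auto simp: r_def)
      moreover have "\<beta> \<le> lead q" if "\<beta> \<in> keys (single \<gamma> c * p)"
      proof -
        obtain \<delta> where "\<delta> \<in> keys p" "\<beta> = \<gamma> + \<delta>"
          using \<open>\<beta> \<in> keys (single \<gamma> c * p)\<close> keys_mult[of "single \<gamma> c" p]
          by (auto split: if_splits)
        then show ?thesis
          using assms(3) add_right_mono[of \<delta> "lead p" \<gamma>] by (simp add: add.commute)
      qed
      ultimately show ?thesis
        by auto
    qed
    ultimately show ?thesis
      by simp
  qed
  then have "r = 0 \<or> lead r < lead q"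
    by (metis Max_in finite_keys keys_eq_empty)
  then show thesis
    using that[of c] by (simp add: r_def)
qed

lemma is_ideal_diff: "is_ideal J \<Longrightarrow> a \<in> J \<Longrightarrow> b \<in> J \<Longrightarrow> a - b \<in> J"
  unfolding is_ideal_iff by (metis diff_conv_add_uminus mult_minus1)

text \<open>
  Pick \<open>p n \<in> J (n + 1) - J n\<close> with minimal leading exponent. By Dickson's lemma the leading
  monomial of some \<open>p i\<close> divides that of a later \<open>p j\<close>, which contradicts the minimality of \<open>p j\<close>.
\<close>

lemma cpoly_ideal_chain:
  fixes J :: "nat \<Rightarrow> 'n::{finite,linorder} cpoly set"
  assumes ideal: "\<And>n. is_ideal (J n)" and inc: "\<And>n. J n \<subseteq> J (Suc n)"
  obtains n where "J (Suc n) \<subseteq> J n"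
proof (rule ccontr)
  assume "\<not> thesis"
  then have "\<exists>p. p \<in> J (Suc n) - J n" for n
    using that by blast
  have "\<exists>p \<in> J (Suc n) - J n. \<forall>q \<in> J (Suc n) - J n. \<not> lead q < lead p" for n
  proof -
    have "wfp (\<lambda>p q :: 'n cpoly. lead p < lead q)"
      by (rule wfp_if_convertible_to_wfp[OF wfp_exponent_less, of _ lead])
    then have "\<exists>p \<in> J (Suc n) - J n. \<forall>q. lead q < lead p \<longrightarrow> q \<notin> J (Suc n) - J n"
      unfolding wfp_eq_minimal
      using \<open>\<exists>p. p \<in> J (Suc n) - J n\<close> by (elim allE[of _ "J (Suc n) - J n"]) simp
    then show ?thesis
      by auto
  qed
  then obtain p where p: "\<And>n. p n \<in> J (Suc n) - J n"
    and min: "\<And>n q. q \<in> J (Suc n) - J n \<Longrightarrow> \<not> lead q < lead (p n)"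
    by metis
  have zero: "0 \<in> J n" for n
    using ideal by (simp add: is_ideal_iff)
  obtain i j \<gamma> where ij: "i < j" "lead (p j) = lead (p i) + \<gamma>"
    by (rule dickson)
  have "p i \<noteq> 0" "p j \<noteq> 0"
    using p zero by (metis DiffD2)+
  then obtain c where c: "p j - single \<gamma> c * p i = 0 \<or> lead (p j - single \<gamma> c * p i) < lead (p j)"
    using lead_reduction ij(2) by metis
  \<comment> \<open>The subtracted multiple of \<open>p i\<close> already lies in
    \<open>J j\<close>, so subtracting it keeps \<open>p j\<close> inside \<open>J (Suc j)\<close>
    and outside \<open>J j\<close>.\<close>
  have "J (Suc i) \<subseteq> J j" "J j \<subseteq> J (Suc j)"
    using lift_Suc_mono_le[of J "Suc i" j] inc ij(1) by auto
  then have m: "single \<gamma> c * p i \<in> J j" "single \<gamma> c * p i \<in> J (Suc j)"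
    using p[of i] ideal[of j] unfolding is_ideal_iff by blast+
  have "p j - single \<gamma> c * p i \<in> J (Suc j)"
    using is_ideal_diff[OF ideal] p m(2) by blast
  moreover have "p j - single \<gamma> c * p i \<notin> J j"
  proof
    assume "p j - single \<gamma> c * p i \<in> J j"
    then have "(p j - single \<gamma> c * p i) + single \<gamma> c * p i \<in> J j"
      using m(1) ideal[of j] unfolding is_ideal_iff by blast
    then show False
      using p[of j] by simp
  qed
  ultimately show False
    using min c zero by (metis DiffI)
qed


subsection \<open>Powers of the maximal ideal\<close>

definition of_cpoly :: "'n::{finite,linorder} cpoly \<Rightarrow> 'n R0" where
  "of_cpoly p = R0_of_fract (Fract p 1)"

lemma to_fract_of_cpoly: "to_fract (of_cpoly p) = Fract p 1"
  unfolding of_cpoly_def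
  by (rule R0_of_fract_inverse, rule CollectI, rule R0_memI) (simp add: eval0_eq)

lemma of_cpoly_hom [simp]:
  "of_cpoly 0 = 0" "of_cpoly 1 = 1"
  "of_cpoly (p + q) = of_cpoly p + of_cpoly q"
  "of_cpoly (p - q) = of_cpoly p - of_cpoly q"
  "of_cpoly (p * q) = of_cpoly p * of_cpoly q"
  by (simp_all add: to_fract_of_cpoly zero_R0.rep_eq one_R0.rep_eq plus_R0.rep_eq minus_R0.rep_eq
      times_R0.rep_eq Zero_fract_def One_fract_def flip: to_fract_inject)

lemma of_cpoly_unit:
  fixes q :: "'n::{finite,linorder} cpoly"
  assumes "eval0 q \<noteq> 0"
  obtains v where "to_fract v = Fract 1 q" "of_cpoly q * v = 1"
proof
  show *: "to_fract (R0_of_fract (Fract 1 q)) = Fract 1 q"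
    by (rule R0_of_fract_inverse, rule CollectI, rule R0_memI, rule assms)
  show "of_cpoly q * R0_of_fract (Fract 1 q) = 1"
    using eval0_nonzeroD[OF assms]
    by (simp add: to_fract_of_cpoly * one_R0.rep_eq times_R0.rep_eq One_fract_def eq_fract
        flip: to_fract_inject)
qed

text \<open>Writes \<open>f\<close> as a polynomial times a unit, so that membership of
  \<open>f\<close> in an ideal can be tested on its numerator.\<close>

lemma R0_fraction:
  fixes f :: "'n::{finite,linorder} R0"
  obtains p q v where "eval0 q \<noteq> 0" "to_fract f = Fract p q"
    "of_cpoly q * v = 1" "f = of_cpoly p * v"
proof -
  obtain p q where pq: "eval0 q \<noteq> 0" "to_fract f = Fract p q"
    by (rule R0_cases)
  obtain v where v: "to_fract v = Fract 1 q" "of_cpoly q * v = 1"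
    using of_cpoly_unit pq(1) by blast
  have "f = of_cpoly p * v"
    by (simp add: to_fract_of_cpoly v(1) pq(2) times_R0.rep_eq flip: to_fract_inject)
  with pq v(2) show thesis
    using that by blast
qed

section \<open>Total degree and order of vanishing at the origin\<close>

definition tdeg :: "('n::finite \<Rightarrow>\<^sub>0 nat) \<Rightarrow> nat" where
  "tdeg \<beta> = (\<Sum>i\<in>UNIV. lookup \<beta> i)"

lemma tdeg_zero [simp]: "tdeg 0 = 0"
  by (simp add: tdeg_def)

lemma tdeg_add: "tdeg (\<beta> + \<gamma>) = tdeg \<beta> + tdeg \<gamma>"
  by (simp add: tdeg_def lookup_add sum.distrib)

lemma tdeg_single [simp]: "tdeg (single i n) = n"
  by (simp add: tdeg_def lookup_single when_def)

lemma tdeg_eq_0_iff [simp]: "tdeg \<beta> = 0 \<longleftrightarrow> \<beta> = 0"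
  by (auto simp: tdeg_def intro: poly_mapping_eqI)

text \<open>Every entry is bounded by the total degree. This provides the finite index sets for
  elements of \<open>D0\<close>.\<close>

lemma finite_tdeg_less: "finite {\<beta> :: 'n::finite \<Rightarrow>\<^sub>0 nat. tdeg \<beta> < k}"
proof (rule finite_imageD)
  have "lookup \<beta> i < k" if "tdeg \<beta> < k" for \<beta> :: "'n \<Rightarrow>\<^sub>0 nat" and i
    using that member_le_sum[of i UNIV "lookup \<beta>"] by (simp add: tdeg_def)
  then have "lookup ` {\<beta> :: 'n \<Rightarrow>\<^sub>0 nat. tdeg \<beta> < k}
      \<subseteq> {f. \<forall>x. (x \<in> UNIV \<longrightarrow> f x \<in> {..<k}) \<and> (x \<notin> UNIV \<longrightarrow> f x = 0)}"
    by auto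
  then show "finite (lookup ` {\<beta> :: 'n \<Rightarrow>\<^sub>0 nat. tdeg \<beta> < k})"
    by (rule finite_subset) (intro finite_set_of_finite_funs finite finite_lessThan)
  show "inj_on lookup {\<beta> :: 'n \<Rightarrow>\<^sub>0 nat. tdeg \<beta> < k}"
    by (simp add: inj_on_def poly_mapping_eqI)
qed

definition ord_ge :: "nat \<Rightarrow> 'n::finite cpoly \<Rightarrow> bool" where
  "ord_ge k p \<longleftrightarrow> (\<forall>\<beta>\<in>keys p. k \<le> tdeg \<beta>)"

lemma ord_ge_0 [simp]: "ord_ge 0 p"
  by (simp add: ord_ge_def)

lemma ord_ge_mono: "ord_ge l p \<Longrightarrow> k \<le> l \<Longrightarrow> ord_ge k p"
  by (force simp: ord_ge_def)

lemma ord_ge_diff: "ord_ge k p \<Longrightarrow> ord_ge k q \<Longrightarrow> ord_ge k (p - q)"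
  unfolding ord_ge_def using keys_diff[of p q] by blast

lemma ord_ge_mult: "ord_ge k p \<Longrightarrow> ord_ge l q \<Longrightarrow> ord_ge (k + l) (p * q)"
  unfolding ord_ge_def using keys_mult[of p q] by (fastforce simp: tdeg_add)

lemma ord_ge_power: "ord_ge 1 p \<Longrightarrow> ord_ge k (p ^ k)"
  by (induction k) (use ord_ge_mult[of 1] in auto)

lemma ord_ge_pderiv: "ord_ge k p \<Longrightarrow> ord_ge (k - 1) (pderiv_poly i p)"
  by (force simp: ord_ge_def in_keys_iff lookup_pderiv_poly tdeg_add)

text \<open>This is the k-th power of the maximal ideal, described through the order of a numerator
  instead of sums of k-fold products.\<close>

definition maxpow :: "nat \<Rightarrow> 'n::{finite,linorder} R0 set" where
  "maxpow k = {of_cpoly p * v | p v. ord_ge k p}"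

lemma maxpow_of_cpoly: "ord_ge k p \<Longrightarrow> of_cpoly p \<in> maxpow k"
  unfolding maxpow_def by (intro CollectI exI[of _ p] exI[of _ 1]) simp

lemma maxpow_mult: "f \<in> maxpow k \<Longrightarrow> h * f \<in> maxpow k"
  unfolding maxpow_def using mult.left_commute by blast

lemma maxpow_Fract:
  fixes f :: "'n::{finite,linorder} R0"
  assumes "f \<in> maxpow k"
  obtains p q where "ord_ge k p" "eval0 q \<noteq> 0" "to_fract f = Fract p q"
proof -
  obtain p v where p: "ord_ge k p" "f = of_cpoly p * v"
    using assms by (auto simp: maxpow_def)
  obtain a b where b: "eval0 b \<noteq> 0" "to_fract v = Fract a b"
    by (rule R0_cases)
  have "to_fract f = Fract (p * a) b"
    by (simp add: p(2) to_fract_of_cpoly b(2) times_R0.rep_eq)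
  then show thesis
    using that b(1) ord_ge_mult[OF p(1) ord_ge_0[of a]] by (metis add.right_neutral)
qed

lemma maxpow_FractI:
  fixes f :: "'n::{finite,linorder} R0"
  assumes "ord_ge k p" "eval0 q \<noteq> 0" "to_fract f = Fract p q"
  shows "f \<in> maxpow k"
proof -
  obtain v where "to_fract v = Fract 1 q" "of_cpoly q * v = 1"
    using of_cpoly_unit assms(2) by blast
  then have "f = of_cpoly p * v"
    by (simp add: to_fract_of_cpoly assms(3) times_R0.rep_eq flip: to_fract_inject)
  then show ?thesis
    using assms(1) by (auto simp: maxpow_def)
qed

text \<open>Taylor approximation: for f = p/q the factor 1/q is expanded into a geometric series,
  cut off after k terms.\<close>

lemma maxpow_approx:
  fixes f :: "'n::{finite,linorder} R0"
  obtains r where "f - of_cpoly r \<in> maxpow k"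
proof -
  obtain p q v where q: "eval0 q \<noteq> 0" "of_cpoly q * v = 1" "f = of_cpoly p * v"
    by (rule R0_fraction)
  \<comment> \<open>The constant \<open>c\<close> inverts the constant term of \<open>q\<close>.
    Hence \<open>n\<close> vanishes at the origin, \<open>n ^ k\<close> has order at least
    \<open>k\<close>, and \<open>c * q = 1 - n\<close> makes the geometric sum telescope.\<close>
  define c where "c = single (0 :: 'n \<Rightarrow>\<^sub>0 nat) (1 / lookup q 0)"
  define n where "n = 1 - c * q"
  define r where "r = p * c * (\<Sum>j<k. n ^ j)"
  have "lookup n 0 = 0"
    using q(1) by (simp add: n_def c_def lookup_minus lookup_mult_0 eval0_eq)
  then have "ord_ge 1 n"
    by (auto simp: ord_ge_def in_keys_iff Suc_le_eq simp flip: neq0_conv)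
  then have *: "ord_ge k (p * n ^ k)"
    using ord_ge_mult[OF ord_ge_0 ord_ge_power] by fastforce
  have "q * r = p * ((1 - n) * (\<Sum>j<k. n ^ j))"
    by (simp add: r_def n_def ac_simps)
  also have "\<dots> = p - p * n ^ k"
    unfolding one_diff_power_eq[symmetric] by (simp add: right_diff_distrib)
  finally have qr: "p * n ^ k = p - q * r"
    by simp
  have "f - of_cpoly r = of_cpoly p * v - (of_cpoly q * v) * of_cpoly r"
    by (simp add: q)
  also have "\<dots> = of_cpoly (p * n ^ k) * v"
    unfolding qr by (simp add: algebra_simps)
  finally show thesis
    using that * unfolding maxpow_def by blast
qed


subsection \<open>Functionals in \<^term>\<open>D0\<close>\<close>

text \<open>Over a common denominator, the quotient rule and the value at the origin become additive
  in the numerators.\<close>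

lemma R0_common_denominator:
  fixes f g :: "'n::{finite,linorder} R0"
  obtains p p' q where "eval0 q \<noteq> 0" "to_fract f = Fract p q" "to_fract g = Fract p' q"
proof -
  obtain p q where 1: "eval0 q \<noteq> 0" "q \<noteq> 0" "to_fract f = Fract p q"
    by (rule R0_cases)
  obtain p' q' where 2: "eval0 q' \<noteq> 0" "q' \<noteq> 0" "to_fract g = Fract p' q'"
    by (rule R0_cases)
  have "to_fract f = Fract (p * q') (q * q')" "to_fract g = Fract (p' * q) (q * q')"
    using 1 2 by (simp_all add: eq_fract)
  moreover have "eval0 (q * q') \<noteq> 0"
    using 1 2 by (simp add: eval0_mult)
  ultimately show thesis
    using that by blast
qed

lemma add_Fract_same:
  assumes "(q :: 'a::idom) \<noteq> 0"
  shows "Fract p q + Fract p' q = Fract (p + p') q"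
proof -
  have "Fract p q + Fract p' q = Fract (q * (p + p')) (q * q)"
    by (simp only: add_fract[OF assms assms] distrib_left mult.commute)
  then show ?thesis
    by (simp only: mult_fract_cancel[OF assms])
qed

abbreviation scale_R0 :: "complex \<Rightarrow> 'n::{finite,linorder} R0 \<Rightarrow> 'n R0" where
  "scale_R0 c f \<equiv> of_cpoly (single 0 c) * f"

lemma pderiv_R0_add: "pderiv_R0 i (f + g) = pderiv_R0 i f + pderiv_R0 i g"
proof -
  obtain p p' q where q: "eval0 q \<noteq> 0" "to_fract f = Fract p q" "to_fract g = Fract p' q"
    by (rule R0_common_denominator)
  have nz: "q \<noteq> 0" "q * q \<noteq> 0"
    using eval0_nonzeroD[OF q(1)] by simp_all
  have fg: "to_fract (f + g) = Fract (p + p') q"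
    by (simp only: plus_R0.rep_eq q add_Fract_same[OF nz(1)])
  have "pderiv_poly i (p + p') * q - (p + p') * pderiv_poly i q
      = (pderiv_poly i p * q - p * pderiv_poly i q) + (pderiv_poly i p' * q - p' * pderiv_poly i q)"
    by (simp add: pderiv_poly_add algebra_simps)
  then have "to_fract (pderiv_R0 i (f + g)) = to_fract (pderiv_R0 i f + pderiv_R0 i g)"
    unfolding pderiv_R0.rep_eq fg unfolding plus_R0.rep_eq pderiv_R0.rep_eq q(2,3)
    by (simp only: pderiv_fract_Fract[OF nz(1)] add_Fract_same[OF nz(2)])
  then show ?thesis
    by (simp only: to_fract_inject)
qed

lemma to_fract_scale:
  assumes "to_fract f = Fract p q"
  shows "to_fract (scale_R0 c f) = Fract (single 0 c * p) q"
  by (simp add: assms times_R0.rep_eq to_fract_of_cpoly)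

lemma pderiv_R0_scale: "pderiv_R0 i (scale_R0 c f) = scale_R0 c (pderiv_R0 i f)"
proof -
  obtain p q where q: "eval0 q \<noteq> 0" "q \<noteq> 0" "to_fract f = Fract p q"
    by (rule R0_cases)
  have "pderiv_poly i (single 0 c) = 0"
    by (simp add: pderiv_poly_single)
  then have "pderiv_poly i (single 0 c * p) * q - single 0 c * p * pderiv_poly i q
      = single 0 c * (pderiv_poly i p * q - p * pderiv_poly i q)"
    by (simp add: pderiv_poly_mult algebra_simps)
  moreover have "to_fract (pderiv_R0 i f) = Fract (pderiv_poly i p * q - p * pderiv_poly i q) (q * q)"
    by (simp only: pderiv_R0.rep_eq q(3) pderiv_fract_Fract[OF q(2)])
  note to_fract_scale[OF this, of c]
  ultimately have "to_fract (pderiv_R0 i (scale_R0 c f)) = to_fract (scale_R0 c (pderiv_R0 i f))"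
    by (simp only: pderiv_R0.rep_eq to_fract_scale[OF q(3)] pderiv_fract_Fract[OF q(2)])
  then show ?thesis
    by (simp only: to_fract_inject)
qed

text \<open>In the quotient rule the new numerator loses at most one order, and the squared
  denominator stays nonzero at the origin.\<close>

lemma pderiv_R0_maxpow:
  assumes "f \<in> maxpow k"
  shows "pderiv_R0 i f \<in> maxpow (k - 1)"
proof -
  obtain p q where q: "ord_ge k p" "eval0 q \<noteq> 0" "to_fract f = Fract p q"
    using assms by (rule maxpow_Fract)
  have "ord_ge (k - 1) (pderiv_poly i p * q - p * pderiv_poly i q)"
    using ord_ge_mult[OF ord_ge_pderiv[OF q(1), of i] ord_ge_0[of q]]
      ord_ge_mono[OF ord_ge_mult[OF q(1) ord_ge_0[of "pderiv_poly i q"]], of "k - 1"]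
    by (intro ord_ge_diff) simp_all
  moreover have "eval0 (q * q) \<noteq> 0"
    using q(2) by (simp add: eval0_mult)
  moreover have "to_fract (pderiv_R0 i f) = Fract (pderiv_poly i p * q - p * pderiv_poly i q) (q * q)"
    by (simp only: pderiv_R0.rep_eq q(3) pderiv_fract_Fract[OF eval0_nonzeroD[OF q(2)]])
  ultimately show ?thesis
    by (rule maxpow_FractI)
qed

lemma value0_add: "value0 (f + g) = value0 f + value0 g"
proof -
  obtain p p' q where q: "eval0 q \<noteq> 0" "to_fract f = Fract p q" "to_fract g = Fract p' q"
    by (rule R0_common_denominator)
  have "to_fract (f + g) = Fract (p + p') q"
    by (simp only: plus_R0.rep_eq q add_Fract_same[OF eval0_nonzeroD[OF q(1)]])
  then show ?thesis
    using q by (simp add: value0_eq eval0_eq lookup_add add_divide_distrib)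
qed

lemma value0_scale: "value0 (scale_R0 c f) = c * value0 f"
proof -
  obtain p q where q: "eval0 q \<noteq> 0" "q \<noteq> 0" "to_fract f = Fract p q"
    by (rule R0_cases)
  show ?thesis
    by (simp add: value0_eq[OF q(1) to_fract_scale[OF q(3)]] value0_eq[OF q(1,3)] eval0_eq
        lookup_mult_0)
qed

lemma value0_maxpow:
  assumes "f \<in> maxpow k" "k > 0"
  shows "value0 f = 0"
proof -
  obtain p q where q: "ord_ge k p" "eval0 q \<noteq> 0" "to_fract f = Fract p q"
    using assms(1) by (rule maxpow_Fract)
  have "0 \<notin> keys p"
    using q(1) assms(2) unfolding ord_ge_def by fastforce
  then have "lookup p 0 = 0"
    by (simp add: in_keys_iff)
  then show ?thesis
    using value0_eq[OF q(2,3)] by (simp add: eval0_eq)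
qed

section \<open>Linear functionals vanishing on a power of the maximal ideal\<close>

definition clinear_R0 :: "('n::{finite,linorder} R0 \<Rightarrow> complex) \<Rightarrow> bool" where
  "clinear_R0 \<phi> \<longleftrightarrow>
     (\<forall>f g. \<phi> (f + g) = \<phi> f + \<phi> g) \<and> (\<forall>c f. \<phi> (scale_R0 c f) = c * \<phi> f)"

lemma clinear_R0_zero: "clinear_R0 \<phi> \<Longrightarrow> \<phi> 0 = 0"
  unfolding clinear_R0_def by (metis add_cancel_right_left)

lemma clinear_R0_diff: "clinear_R0 \<phi> \<Longrightarrow> \<phi> (f - g) = \<phi> f - \<phi> g"
  unfolding clinear_R0_def by (metis add_diff_cancel_right' diff_add_cancel)

lemma
  shows mixed_pderiv_add: "mixed_pderiv \<alpha> (f + g) = mixed_pderiv \<alpha> f + mixed_pderiv \<alpha> g"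
    and mixed_pderiv_scale: "mixed_pderiv \<alpha> (scale_R0 c f) = scale_R0 c (mixed_pderiv \<alpha> f)"
    and mixed_pderiv_maxpow: "f \<in> maxpow k \<Longrightarrow> mixed_pderiv \<alpha> f \<in> maxpow (k - tdeg \<alpha>)"
proof -
  let ?D = "\<lambda>xs. foldr (\<lambda>i. pderiv_R0 i ^^ lookup \<alpha> i) xs"
  have 1: "(pderiv_R0 i ^^ n) (f + g) = (pderiv_R0 i ^^ n) f + (pderiv_R0 i ^^ n) g"
    for i n and f g :: "'a R0"
    by (induction n) (simp_all add: pderiv_R0_add)
  have "?D xs (f + g) = ?D xs f + ?D xs g" for xs
    by (induction xs) (simp_all add: 1)
  then show "mixed_pderiv \<alpha> (f + g) = mixed_pderiv \<alpha> f + mixed_pderiv \<alpha> g"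
    unfolding mixed_pderiv_def .
  have 2: "(pderiv_R0 i ^^ n) (scale_R0 c f) = scale_R0 c ((pderiv_R0 i ^^ n) f)"
    for i n and f :: "'a R0"
    by (induction n) (simp_all add: pderiv_R0_scale)
  have "?D xs (scale_R0 c f) = scale_R0 c (?D xs f)" for xs
    by (induction xs) (simp_all add: 2)
  then show "mixed_pderiv \<alpha> (scale_R0 c f) = scale_R0 c (mixed_pderiv \<alpha> f)"
    unfolding mixed_pderiv_def .
  have 3: "(pderiv_R0 i ^^ n) f \<in> maxpow (k - n)" if "f \<in> maxpow k" for i n k and f :: "'a R0"
    by (induction n) (use that pderiv_R0_maxpow in fastforce)+
  have 4: "?D xs f \<in> maxpow (k - (\<Sum>i\<leftarrow>xs. lookup \<alpha> i))"
    if "f \<in> maxpow k" for xs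
  proof (induction xs)
    case (Cons i xs)
    show ?case
      using 3[OF Cons.IH, where i = i and n = "lookup \<alpha> i"] by (simp add: add.commute)
  qed (use that in simp)
  \<comment> \<open>The list contains each variable exactly once, so the total loss of order is the
    total degree.\<close>
  have "(\<Sum>i\<leftarrow>sorted_list_of_set UNIV. lookup \<alpha> i) = tdeg \<alpha>"
    by (simp add: tdeg_def sum_list_distinct_conv_sum_set)
  then show "mixed_pderiv \<alpha> f \<in> maxpow (k - tdeg \<alpha>)" if "f \<in> maxpow k"
    using 4[OF that, of "sorted_list_of_set UNIV"] by (simp add: mixed_pderiv_def)
qed

lemma dpart_add: "dpart \<alpha> (f + g) = dpart \<alpha> f + dpart \<alpha> g"
  by (simp add: dpart_def mixed_pderiv_add value0_add add_divide_distrib)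

lemma dpart_scale: "dpart \<alpha> (scale_R0 c f) = c * dpart \<alpha> f"
  by (simp add: dpart_def mixed_pderiv_scale value0_scale)

lemma clinear_R0_dpart: "clinear_R0 (dpart \<alpha>)"
  by (simp add: clinear_R0_def dpart_add dpart_scale)

text \<open>Fewer than \<open>k\<close> derivatives leave a positive order of vanishing, hence the
  value 0 at the origin.\<close>

lemma dpart_maxpow: "f \<in> maxpow k \<Longrightarrow> tdeg \<alpha> < k \<Longrightarrow> dpart \<alpha> f = 0"
  using value0_maxpow[OF mixed_pderiv_maxpow] by (simp add: dpart_def)

text \<open>Monomials of degree at least \<open>k\<close> are killed, so finitely many values of
  \<open>\<phi>\<close> determine it on polynomials.\<close>

lemma clinear_R0_of_cpoly:
  fixes \<phi> :: "'n::{finite,linorder} R0 \<Rightarrow> complex"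
  assumes "clinear_R0 \<phi>" and "\<And>f. f \<in> maxpow k \<Longrightarrow> \<phi> f = 0"
  shows "\<phi> (of_cpoly r) = (\<Sum>\<alpha> | tdeg \<alpha> < k. \<phi> (of_cpoly (single \<alpha> 1)) * lookup r \<alpha>)"
proof (induction r rule: cpoly_induct)
  case zero
  show ?case
    using clinear_R0_zero[OF assms(1)] by simp
next
  case (add p \<beta> c)
  have "\<phi> (of_cpoly (single \<beta> c)) = c * \<phi> (of_cpoly (single \<beta> 1))"
    using assms(1) unfolding clinear_R0_def
    by (metis add_0 mult.right_neutral mult_single of_cpoly_hom(5))
  moreover have "\<phi> (of_cpoly (single \<beta> 1)) = 0" if "\<not> tdeg \<beta> < k"
    using that by (intro assms(2) maxpow_of_cpoly) (simp add: ord_ge_def)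
  ultimately have "\<phi> (of_cpoly (single \<beta> c))
      = (\<Sum>\<alpha> | tdeg \<alpha> < k. \<phi> (of_cpoly (single \<alpha> 1)) * lookup (single \<beta> c) \<alpha>)"
    using finite_tdeg_less[where 'n='n and k=k]
    by (auto simp: lookup_single when_def if_distrib cong: if_cong)
  then show ?case
    using add assms(1) by (simp add: clinear_R0_def lookup_add distrib_left sum.distrib)
qed

text \<open>Replaces the span by an intrinsic condition under which functionals can be constructed
  without naming coefficients.\<close>

lemma D0_iff:
  "\<phi> \<in> D0 \<longleftrightarrow> clinear_R0 \<phi> \<and> (\<exists>k. \<forall>f\<in>maxpow k. \<phi> f = 0)"
proof
  assume "\<phi> \<in> D0"
  then obtain A c where A: "finite A" "\<phi> = (\<lambda>f. \<Sum>\<alpha>\<in>A. c \<alpha> * dpart \<alpha> f)"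
    by (auto simp: D0_def)
  have "clinear_R0 \<phi>"
    unfolding A(2) clinear_R0_def
    by (simp add: dpart_add dpart_scale distrib_left sum.distrib sum_distrib_left mult.left_commute)
  \<comment> \<open>The exponent only has to exceed the total degree of every index in
    \<open>A\<close>; one more than their sum does.\<close>
  moreover have "\<phi> f = 0" if "f \<in> maxpow (Suc (\<Sum>\<alpha>\<in>A. tdeg \<alpha>))" for f
    unfolding A(2) using dpart_maxpow[OF that] member_le_sum[OF _ _ A(1), of _ tdeg]
    by (intro sum.neutral) (simp add: le_imp_less_Suc)
  ultimately show "clinear_R0 \<phi> \<and> (\<exists>k. \<forall>f\<in>maxpow k. \<phi> f = 0)"
    by blast
next
  assume "clinear_R0 \<phi> \<and> (\<exists>k. \<forall>f\<in>maxpow k. \<phi> f = 0)"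
  then obtain k where lin: "clinear_R0 \<phi>" and k: "\<And>f. f \<in> maxpow k \<Longrightarrow> \<phi> f = 0"
    by blast
  \<comment> \<open>The coefficient of \<open>dpart \<alpha>\<close> is the value of
    \<open>\<phi>\<close> on the monomial with exponent \<open>\<alpha>\<close>. Neither
    \<open>\<phi>\<close> nor these \<open>dpart \<alpha>\<close> can distinguish \<open>f\<close>
    from its Taylor polynomial \<open>r\<close>.\<close>
  have "\<phi> f = (\<Sum>\<alpha> | tdeg \<alpha> < k. \<phi> (of_cpoly (single \<alpha> 1)) * dpart \<alpha> f)" for f
  proof -
    obtain r where r: "f - of_cpoly r \<in> maxpow k"
      by (rule maxpow_approx)
    have "\<phi> f = \<phi> (of_cpoly r)"
      using k[OF r] clinear_R0_diff[OF lin] by simp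
    moreover have "dpart \<alpha> f = lookup r \<alpha>" if "tdeg \<alpha> < k" for \<alpha>
      using dpart_maxpow[OF r that] clinear_R0_diff[OF clinear_R0_dpart, of \<alpha> f]
        dpart_poly[OF to_fract_of_cpoly] by simp
    ultimately show ?thesis
      using clinear_R0_of_cpoly[OF lin k] by simp
  qed
  then show "\<phi> \<in> D0"
    unfolding D0_def using finite_tdeg_less[where k = k]
    by (intro CollectI exI[of _ "{\<alpha>. tdeg \<alpha> < k}"] exI conjI ext)
qed


subsection \<open>Ideals of the local ring\<close>

text \<open>An ideal of the local ring is determined by the polynomials in it, because denominators
  are units; so the chain condition descends from the polynomial ring.\<close>

lemma R0_ideal_chain:
  fixes J :: "nat \<Rightarrow> 'n::{finite,linorder} R0 set"
  assumes ideal: "\<And>n. is_ideal (J n)" and inc: "\<And>n. J n \<subseteq> J (Suc n)"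
  obtains n where "J (Suc n) \<subseteq> J n"
proof -
  have "is_ideal (of_cpoly -` J n)" for n
    using ideal[of n] by (simp add: is_ideal_iff)
  moreover have "of_cpoly -` J n \<subseteq> of_cpoly -` J (Suc n)" for n
    using inc by auto
  ultimately obtain n where n: "of_cpoly -` J (Suc n) \<subseteq> of_cpoly -` J n"
    by (rule cpoly_ideal_chain)
  have "f \<in> J n" if f: "f \<in> J (Suc n)" for f
  proof -
    obtain p q v where v: "of_cpoly q * v = 1" "f = of_cpoly p * v"
      by (rule R0_fraction)
    have "of_cpoly q * f = (of_cpoly q * v) * of_cpoly p"
      by (simp add: v(2) ac_simps)
    then have "of_cpoly q * f = of_cpoly p"
      by (simp add: v(1))
    then have "of_cpoly p \<in> J (Suc n)"
      using f ideal[of "Suc n"] unfolding is_ideal_iff by metis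
    then have "of_cpoly p \<in> J n"
      using n by auto
    then show ?thesis
      using ideal[of n] unfolding is_ideal_iff v(2) by (metis mult.commute)
  qed
  then show thesis
    using that by blast
qed

lemma is_ideal_sum:
  assumes "is_ideal J" "\<And>x. x \<in> A \<Longrightarrow> f x \<in> J"
  shows "sum f A \<in> J"
  using assms by (induction A rule: infinite_finite_induct) (auto simp: is_ideal_iff)

lemma of_cpoly_eq_sum:
  "of_cpoly p = (\<Sum>\<beta>\<in>keys p. of_cpoly (single \<beta> (lookup p \<beta>)))"
proof -
  have "(\<Sum>\<beta>\<in>A. of_cpoly (single \<beta> (lookup p \<beta>))) = of_cpoly (\<Sum>\<beta>\<in>A. single \<beta> (lookup p \<beta>))" for A
    by (induction A rule: infinite_finite_induct) simp_all
  moreover have "p = (\<Sum>\<beta>\<in>keys p. single \<beta> (lookup p \<beta>))"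
    by (rule poly_mapping_eqI) (auto simp: lookup_sum lookup_single when_def in_keys_iff)
  ultimately show ?thesis
    by simp
qed

section \<open>Ideals containing powers of the variables\<close>

definition var :: "'n \<Rightarrow> 'n::{finite,linorder} R0" where
  "var i = of_cpoly (single (single i 1) 1)"

lemma var_power: "var i ^ n = of_cpoly (single (single i n) 1)"
proof (induction n)
  case (Suc n)
  then show ?case
    by (simp add: var_def mult_single flip: of_cpoly_hom(5) single_add)
qed simp

lemma var_power_maxpow: "var i ^ n \<in> maxpow n"
  unfolding var_power by (rule maxpow_of_cpoly) (simp add: ord_ge_def)

text \<open>Pigeonhole: among N exponents with sum at least N n, one is at least n, so the monomial
  is a multiple of some \<open>var i ^ n\<close>.\<close>

lemma maxpow_subset_ideal:
  fixes P :: "'n::{finite,linorder} R0 set"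
  assumes ideal: "is_ideal P" and var: "\<And>i. var i ^ n \<in> P"
  shows "maxpow (card (UNIV :: 'n set) * n) \<subseteq> P"
proof -
  have "of_cpoly (single \<beta> c) \<in> P" if \<beta>: "card (UNIV :: 'n set) * n \<le> tdeg \<beta>" for \<beta> :: "'n \<Rightarrow>\<^sub>0 nat" and c
  proof -
    have "\<exists>i. n \<le> lookup \<beta> i"
    proof (rule ccontr)
      assume "\<not> ?thesis"
      then have "tdeg \<beta> < card (UNIV :: 'n set) * n"
        unfolding tdeg_def using sum_bounded_above_strict[of UNIV "lookup \<beta>" n]
        by (simp add: not_le card_gt_0_iff)
      with \<beta> show False
        by simp
    qed
    then obtain i where i: "n \<le> lookup \<beta> i"
      by blast
    have "single \<beta> c = single (\<beta> - single i n) c * single (single i n) 1"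
      unfolding mult_single using i
      by (intro arg_cong2[of _ _ _ _ single] poly_mapping_eqI)
        (auto simp: lookup_add lookup_minus lookup_single when_def)
    then show ?thesis
      using var[of i] ideal unfolding var_power is_ideal_iff by (metis of_cpoly_hom(5))
  qed
  then have "of_cpoly p \<in> P" if "ord_ge (card (UNIV :: 'n set) * n) p" for p
    using that unfolding of_cpoly_eq_sum[of p] ord_ge_def by (intro is_ideal_sum[OF ideal]) auto
  then show ?thesis
    using ideal unfolding maxpow_def is_ideal_iff by (auto simp: mult.commute)
qed

text \<open>
  A substitute for the Artin-Rees lemma: among the ideals \<open>P \<supseteq> I + gQ\<close> with \<open>P : g \<subseteq> Q\<close>, a maximal
  one contains a power of every variable. Indeed, once \<open>P : x\<^sup>n\<close> is stationary, \<open>P + (x\<^sup>n)\<close>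
  is again such an ideal.
\<close>

lemma colon_primary:
  fixes I Q :: "'n::{finite,linorder} R0 set"
  assumes I: "is_ideal I" and Q: "is_ideal Q"
    and IQ: "\<And>f. g * f \<in> I \<Longrightarrow> f \<in> Q" and d: "maxpow d \<subseteq> Q"
  obtains P k where "is_ideal P" "I \<subseteq> P" "\<And>f. g * f \<in> P \<Longrightarrow> f \<in> Q" "maxpow k \<subseteq> P"
proof -
  \<comment> \<open>Every member satisfies P : g = Q. The inclusion of gQ in P is what later puts
    \<open>g * (f * ?x ^ d)\<close> into \<open>P\<close>. The set \<open>P0\<close> shows that the
    family is nonempty.\<close>
  define \<A> where "\<A> = {P. is_ideal P \<and> I \<subseteq> P \<and> (\<forall>f\<in>Q. g * f \<in> P) \<and> (\<forall>f. g * f \<in> P \<longrightarrow> f \<in> Q)}"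
  define P0 where "P0 = {a + g * f | a f. a \<in> I \<and> f \<in> Q}"
  have I': "0 \<in> I" "a \<in> I \<Longrightarrow> b \<in> I \<Longrightarrow> a + b \<in> I" "a \<in> I \<Longrightarrow> r * a \<in> I" for a b r
    using I by (auto simp: is_ideal_iff)
  have Q': "0 \<in> Q" "a \<in> Q \<Longrightarrow> b \<in> Q \<Longrightarrow> a + b \<in> Q" "a \<in> Q \<Longrightarrow> r * a \<in> Q" for a b r
    using Q by (auto simp: is_ideal_iff)
  have P0I: "a + g * f \<in> P0" if "a \<in> I" "f \<in> Q" for a f
    using that by (auto simp: P0_def)
  have "is_ideal P0"
    unfolding is_ideal_iff
  proof (intro conjI ballI allI)
    show "0 \<in> P0"
      using P0I[OF I'(1) Q'(1)] by simp
  next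
    fix x y
    assume "x \<in> P0" "y \<in> P0"
    then obtain a f b h where "a \<in> I" "f \<in> Q" "b \<in> I" "h \<in> Q" "x = a + g * f" "y = b + g * h"
      by (auto simp: P0_def)
    then show "x + y \<in> P0"
      using P0I[OF I'(2)[of a b] Q'(2)[of f h]] by (simp add: algebra_simps)
  next
    fix r x
    assume "x \<in> P0"
    then obtain a f where "a \<in> I" "f \<in> Q" "x = a + g * f"
      by (auto simp: P0_def)
    then show "r * x \<in> P0"
      using P0I[OF I'(3)[of a r] Q'(3)[of f r]] by (simp add: algebra_simps)
  qed
  moreover have "I \<subseteq> P0"
    using P0I[OF _ Q'(1)] by auto
  moreover have "\<forall>f\<in>Q. g * f \<in> P0"
    using P0I[OF I'(1)] by auto
  moreover have "f \<in> Q" if gf: "g * f \<in> P0" for f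
  proof -
    obtain a h where ah: "a \<in> I" "h \<in> Q" "g * f = a + g * h"
      using gf by (auto simp: P0_def)
    have "g * (f - h) = a"
      using ah(3) by (simp add: algebra_simps)
    then have "(f - h) + h \<in> Q"
      using ah IQ Q'(2) by blast
    then show ?thesis
      by simp
  qed
  ultimately have "P0 \<in> \<A>"
    by (auto simp: \<A>_def)
  moreover have "\<Union>\<C> \<in> \<A>" if "\<C> \<noteq> {}" "subset.chain \<A> \<C>" for \<C>
  proof -
    have chain: "\<C> \<subseteq> \<A>" "\<And>X Y. X \<in> \<C> \<Longrightarrow> Y \<in> \<C> \<Longrightarrow> X \<subseteq> Y \<or> Y \<subseteq> X"
      using that(2) by (auto simp: subset_chain_def)
    have "is_ideal (\<Union>\<C>)"
      unfolding is_ideal_iff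
    proof (intro conjI ballI allI)
      show "0 \<in> \<Union>\<C>"
        using that(1) chain(1) by (auto simp: \<A>_def is_ideal_iff)
    next
      fix a b
      assume "a \<in> \<Union>\<C>" "b \<in> \<Union>\<C>"
      then obtain X where "X \<in> \<C>" "a \<in> X" "b \<in> X"
        using chain(2) by blast
      moreover from \<open>X \<in> \<C>\<close> have "is_ideal X"
        using chain(1) by (auto simp: \<A>_def)
      ultimately show "a + b \<in> \<Union>\<C>"
        unfolding is_ideal_iff by blast
    next
      fix r a
      assume "a \<in> \<Union>\<C>"
      then obtain X where "X \<in> \<C>" "a \<in> X"
        by blast
      moreover from \<open>X \<in> \<C>\<close> have "is_ideal X"
        using chain(1) by (auto simp: \<A>_def)
      ultimately show "r * a \<in> \<Union>\<C>"
        unfolding is_ideal_iff by blast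
    qed
    then show ?thesis
      using that(1) chain(1) unfolding \<A>_def by blast
  qed
  ultimately obtain P where P: "P \<in> \<A>" and max: "\<And>X. X \<in> \<A> \<Longrightarrow> P \<subseteq> X \<Longrightarrow> X = P"
    using subset_Zorn_nonempty[of \<A>] by blast
  have P': "is_ideal P" "I \<subseteq> P" "\<And>f. f \<in> Q \<Longrightarrow> g * f \<in> P" "\<And>f. g * f \<in> P \<Longrightarrow> f \<in> Q"
    using P by (auto simp: \<A>_def)
  have P'': "0 \<in> P" "a \<in> P \<Longrightarrow> b \<in> P \<Longrightarrow> a + b \<in> P" "a \<in> P \<Longrightarrow> r * a \<in> P" for a b r
    using P'(1) by (auto simp: is_ideal_iff)
  have "\<exists>n. var i ^ n \<in> P" for i
  proof -
    let ?x = "var i"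
    \<comment> \<open>These are the colon ideals of \<open>P\<close> by the powers of the variable;
      they increase with \<open>n\<close>.\<close>
    define J where "J n = {a. ?x ^ n * a \<in> P}" for n
    have "is_ideal (J n)" for n
      unfolding is_ideal_iff J_def using P'' by (auto simp: distrib_left mult.left_commute)
    moreover have "J n \<subseteq> J (Suc n)" for n
      using P''(3) by (auto simp: J_def mult.assoc)
    ultimately obtain n where n: "J (Suc n) \<subseteq> J n"
      by (rule R0_ideal_chain)
    have stable: "?x ^ n * a \<in> P" if "?x ^ (n + m) * a \<in> P" for a m
      using that
    proof (induction m arbitrary: a)
      case (Suc m)
      have "?x ^ (n + m) * (?x * a) \<in> P"
        using Suc.prems by (simp add: ac_simps)
      then have "?x ^ n * (?x * a) \<in> P"
        by (rule Suc.IH)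
      then show ?case
        using n by (auto simp: J_def ac_simps)
    qed simp
    define P1 where "P1 = {p + ?x ^ n * a | p a. p \<in> P}"
    have P1I: "p + ?x ^ n * a \<in> P1" if "p \<in> P" for p a
      using that by (auto simp: P1_def)
    have "is_ideal P1"
      unfolding is_ideal_iff
    proof (intro conjI ballI allI)
      show "0 \<in> P1"
        using P1I[OF P''(1), of 0] by simp
    next
      fix y z
      assume "y \<in> P1" "z \<in> P1"
      then obtain p a p' a' where "p \<in> P" "p' \<in> P" "y = p + ?x ^ n * a" "z = p' + ?x ^ n * a'"
        by (auto simp: P1_def)
      then show "y + z \<in> P1"
        using P1I[OF P''(2)[of p p'], of "a + a'"] by (simp add: algebra_simps)
    next
      fix r y
      assume "y \<in> P1"
      then obtain p a where "p \<in> P" "y = p + ?x ^ n * a"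
        by (auto simp: P1_def)
      then show "r * y \<in> P1"
        using P1I[OF P''(3)[of p r], of "r * a"] by (simp add: algebra_simps)
    qed
    moreover have PP1: "P \<subseteq> P1"
      using P1I[of _ 0] by auto
    moreover have "f \<in> Q" if gf: "g * f \<in> P1" for f
    proof -
      obtain p a where pa: "p \<in> P" "g * f = p + ?x ^ n * a"
        using gf by (auto simp: P1_def)
      \<comment> \<open>Multiplying by \<open>?x ^ d\<close> moves \<open>f\<close> into
        \<open>Q\<close>, hence \<open>g * f\<close> into \<open>P\<close>, and leaves
        \<open>?x ^ (n + d) * a\<close> in \<open>P\<close>. Stationarity removes the extra
        \<open>d\<close> factors, so \<open>g * f\<close> itself lies in \<open>P\<close>.\<close>
      have "f * ?x ^ d \<in> Q"
        using d var_power_maxpow[of i d] Q'(3) by blast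
      then have "g * (f * ?x ^ d) \<in> P"
        by (rule P'(3))
      moreover have "g * (f * ?x ^ d) = (g * f) * ?x ^ d"
        by (simp only: mult.assoc)
      then have "g * (f * ?x ^ d) = ?x ^ d * p + ?x ^ (n + d) * a"
        unfolding pa(2) by (simp add: power_add distrib_left ac_simps)
      ultimately have "?x ^ (n + d) * a \<in> P"
        using is_ideal_diff[OF P'(1), of "g * (f * ?x ^ d)" "?x ^ d * p"] P''(3)[OF pa(1)] by simp
      then have "?x ^ n * a \<in> P"
        by (rule stable)
      then show ?thesis
        using P'(4)[of f] P''(2)[OF pa(1)] pa(2) by simp
    qed
    ultimately have "P1 \<in> \<A>"
      using P'(2,3) by (auto simp: \<A>_def)
    then have "P1 = P"
      using max PP1 by blast
    then show ?thesis
      using P1I[OF P''(1), of 1] by auto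
  qed
  then obtain m where m: "\<And>i. var i ^ m i \<in> P"
    by metis
  \<comment> \<open>The sum of all the exponents serves as one exponent common to all
    variables.\<close>
  have "var i ^ (\<Sum>j\<in>UNIV. m j) \<in> P" for i
  proof -
    have "var i ^ (\<Sum>j\<in>UNIV. m j) = var i ^ ((\<Sum>j\<in>UNIV. m j) - m i) * var i ^ m i"
      using member_le_sum[of i UNIV m] by (simp flip: power_add)
    then show ?thesis
      using P''(3)[OF m] by simp
  qed
  then show thesis
    using that maxpow_subset_ideal[OF P'(1)] P' by blast
qed

section \<open>Extension of linear functionals over the complex numbers\<close>

lemma scale_R0_1: "scale_R0 1 f = f"
  by (simp only: single_one of_cpoly_hom(2) mult_1)

interpretation R0: vector_space scale_R0
  by unfold_locales
    (simp_all add: distrib_left single_add distrib_right mult_single scale_R0_1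
      flip: of_cpoly_hom(5) mult.assoc)

interpretation R0_functional: vector_space_pair scale_R0 "(*) :: complex \<Rightarrow> complex \<Rightarrow> complex"
  by unfold_locales (simp_all add: algebra_simps)

text \<open>The values of \<open>\<psi>\<close> on a basis of \<open>S\<close> are extended linearly
  to the whole ring; linearity of \<open>\<psi>\<close> on \<open>S\<close> forces agreement
  there.\<close>

lemma clinear_R0_extend:
  fixes S :: "'n::{finite,linorder} R0 set" and \<psi> :: "'n R0 \<Rightarrow> complex"
  assumes S: "is_ideal S"
    and add: "\<And>a b. a \<in> S \<Longrightarrow> b \<in> S \<Longrightarrow> \<psi> (a + b) = \<psi> a + \<psi> b"
    and scale: "\<And>c a. a \<in> S \<Longrightarrow> \<psi> (scale_R0 c a) = c * \<psi> a"
  shows "\<exists>\<phi>. clinear_R0 \<phi> \<and> (\<forall>a\<in>S. \<phi> a = \<psi> a)"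
proof -
  obtain B where B: "B \<subseteq> S" "R0.independent B" "S \<subseteq> R0.span B"
    by (rule R0.maximal_independent_subset)
  obtain \<phi> where \<phi>: "Vector_Spaces.linear scale_R0 (*) \<phi>" "\<And>b. b \<in> B \<Longrightarrow> \<phi> b = \<psi> b"
    using R0_functional.linear_independent_extend[OF B(2)] by blast
  have lin: "clinear_R0 \<phi>"
    using \<phi>(1) by (simp add: Vector_Spaces.linear_iff clinear_R0_def)
  have S': "0 \<in> S" "a \<in> S \<Longrightarrow> b \<in> S \<Longrightarrow> a + b \<in> S" "a \<in> S \<Longrightarrow> r * a \<in> S" for a b r
    using S by (auto simp: is_ideal_iff)
  \<comment> \<open>Membership in \<open>S\<close> is carried through the induction because
    \<open>\<psi>\<close> is known to be linear only on \<open>S\<close>.\<close>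
  have "a \<in> S \<and> \<phi> a = \<psi> a" if "a \<in> R0.span B" for a
    using that
  proof (induction rule: R0.span_induct_alt)
    case base
    show ?case
      \<comment> \<open>Scaling by 0 gives \<open>\<psi> 0 = 0\<close>.\<close>
      using S'(1) scale[OF S'(1), of 0] clinear_R0_zero[OF lin] by simp
  next
    case (step c x y)
    then show ?case
      using B(1) \<phi>(2) lin S' add scale by (auto simp: clinear_R0_def)
  qed
  then show ?thesis
    using lin B(3) by blast
qed

section \<open>The dual space of a colon ideal\<close>

theorem theorem2p20:
  fixes I :: "'n::{finite,linorder} R0 set" and g :: "'n R0"
  assumes "is_ideal I"
  shows "dual_space (colon_principal I g) = {act g q | q. q \<in> dual_space I}"
proof (intro equalityI subsetI)
  fix \<phi>
  assume "\<phi> \<in> {act g q | q. q \<in> dual_space I}"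
  then obtain q where q: "q \<in> dual_space I" "\<phi> = act g q"
    by blast
  obtain k where lin: "clinear_R0 q" and k: "\<And>f. f \<in> maxpow k \<Longrightarrow> q f = 0"
    using q(1) by (auto simp: dual_space_def D0_iff)
  have "clinear_R0 \<phi>"
    using lin by (simp add: clinear_R0_def q(2) act_def distrib_left mult.left_commute[of g])
  moreover have "\<phi> f = 0" if "f \<in> maxpow k" for f
    using k maxpow_mult[OF that] by (simp add: q(2) act_def)
  ultimately show "\<phi> \<in> dual_space (colon_principal I g)"
    using q by (auto simp: dual_space_def D0_iff act_def colon_principal_def)
next
  fix q
  assume "q \<in> dual_space (colon_principal I g)"
  then obtain d where lin: "clinear_R0 q" and d: "\<And>f. f \<in> maxpow d \<Longrightarrow> q f = 0"
    and colon: "\<And>f. g * f \<in> I \<Longrightarrow> q f = 0"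
    by (auto simp: dual_space_def D0_iff colon_principal_def)
  have q_add: "q (a + b) = q a + q b" and q_scale: "q (scale_R0 c a) = c * q a" for a b c
    using lin by (auto simp: clinear_R0_def)
  define Q where "Q = {f. \<forall>h. q (h * f) = 0}"
  have "is_ideal Q"
    unfolding is_ideal_iff Q_def
    by (simp add: distrib_left q_add clinear_R0_zero[OF lin] flip: mult.assoc)
  moreover have "f \<in> Q" if "g * f \<in> I" for f
    unfolding Q_def
  proof (intro CollectI allI)
    fix h
    have "h * (g * f) \<in> I"
      using that assms by (simp add: is_ideal_iff)
    then show "q (h * f) = 0"
      by (intro colon) (simp add: mult.left_commute)
  qed
  moreover have "maxpow d \<subseteq> Q"
    using d maxpow_mult by (auto simp: Q_def)
  ultimately obtain P k where P: "is_ideal P" "I \<subseteq> P" "\<And>f. g * f \<in> P \<Longrightarrow> f \<in> Q" "maxpow k \<subseteq> P"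
    using colon_primary[OF assms] by metis
  have P': "0 \<in> P" "a \<in> P \<Longrightarrow> b \<in> P \<Longrightarrow> a + b \<in> P" "a \<in> P \<Longrightarrow> r * a \<in> P" for a b r
    using P(1) by (auto simp: is_ideal_iff)
  \<comment> \<open>\<open>S\<close> is the ideal (g) + P, and \<open>\<psi>\<close> sends g f + p
    to \<open>q f\<close> through a chosen representative \<open>f\<close>.\<close>
  define S where "S = {s. \<exists>f. s - g * f \<in> P}"
  define \<psi> where "\<psi> s = q (SOME f. s - g * f \<in> P)" for s
  \<comment> \<open>The choice does not matter: two representatives differ by an element of P : g,
    which lies in \<open>Q\<close> and so in the kernel of \<open>q\<close>.\<close>
  have \<psi>: "\<psi> s = q f" if f: "s - g * f \<in> P" for s f
  proof -
    define h where "h = (SOME f. s - g * f \<in> P)"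
    have h: "s - g * h \<in> P"
      unfolding h_def using f by (rule someI)
    have "g * (f - h) = (s - g * h) - (s - g * f)"
      by (simp add: algebra_simps)
    then have "f - h \<in> Q"
      using P(3) is_ideal_diff[OF P(1) h f] by simp
    then have "q (1 * (f - h)) = 0"
      unfolding Q_def by blast
    then show ?thesis
      by (simp add: \<psi>_def h_def clinear_R0_diff[OF lin])
  qed
  have S_I: "s \<in> S" if "s - g * f \<in> P" for s f
    using that unfolding S_def by blast
  have S_add: "(a + b) - g * (e + f) \<in> P" if "a - g * e \<in> P" "b - g * f \<in> P" for a b e f
    using P'(2)[OF that] by (simp add: algebra_simps)
  have S_mult: "r * a - g * (r * f) \<in> P" if "a - g * f \<in> P" for a f r
    using P'(3)[OF that, of r] by (simp add: algebra_simps)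
  have "is_ideal S"
    unfolding is_ideal_iff
  proof (intro conjI ballI allI)
    have "0 - g * 0 \<in> P"
      using P'(1) by simp
    then show "0 \<in> S"
      unfolding S_def by blast
  qed (use S_add S_mult in \<open>unfold S_def, blast+\<close>)
  moreover have "\<psi> (a + b) = \<psi> a + \<psi> b" if ab: "a \<in> S" "b \<in> S" for a b
  proof -
    obtain e f where "a - g * e \<in> P" "b - g * f \<in> P"
      using ab unfolding S_def by blast
    then show ?thesis
      by (simp only: \<psi>[OF S_add] \<psi> q_add)
  qed
  moreover have "\<psi> (scale_R0 c a) = c * \<psi> a" if a: "a \<in> S" for a c
  proof -
    obtain f where "a - g * f \<in> P"
      using a unfolding S_def by blast
    then show ?thesis
      by (simp only: \<psi>[OF S_mult] \<psi> q_scale)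
  qed
  ultimately obtain \<phi> where \<phi>: "clinear_R0 \<phi>" "\<And>a. a \<in> S \<Longrightarrow> \<phi> a = \<psi> a"
    using clinear_R0_extend[of S \<psi>] by blast
  have "\<phi> a = 0" if "a \<in> P" for a
  proof -
    \<comment> \<open>An element of \<open>P\<close> has the representative 0, so
      \<open>\<phi>\<close> vanishes on \<open>P\<close> and therefore on \<open>I\<close> and on
      \<open>maxpow k\<close>.\<close>
    have "a - g * 0 \<in> P"
      using that by simp
    then show ?thesis
      using \<phi>(2)[OF S_I] \<psi> clinear_R0_zero[OF lin] by metis
  qed
  then have "\<phi> \<in> dual_space I"
    using \<phi>(1) P(2,4) by (auto simp: dual_space_def D0_iff)
  moreover have "act g \<phi> = q"
  proof
    fix f
    \<comment> \<open>The element \<open>g * f\<close> of \<open>S\<close> has the representative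
      \<open>f\<close>, which gives the value \<open>q f\<close>.\<close>
    have "g * f - g * f \<in> P"
      using P'(1) by simp
    then show "act g \<phi> f = q f"
      using \<phi>(2)[OF S_I] \<psi> unfolding act_def by metis
  qed
  ultimately show "q \<in> {act g q | q. q \<in> dual_space I}"
    by blast
qed

end
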